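(* Let $f$ be a recursive permutation of $\mathbb{N}$. The following conditions are equivalent, where all functions are required to be total recursive: (a) there is $\pi$ with $\pi(x,x') = [x \equiv_f x']$ for all $x,x'$; (b) there is $\mu$ with $\mu(x) = \min\{x' : x \equiv_f x'\}$ for all $x$; (c) there is $\vartheta$ such that $x\equiv_f x' \Rightarrow \vartheta(x)=\vartheta(x')$ and $\vartheta(x)\equiv_f x$ for all $x,x'$; (d) there is $\chi$ with $\chi(x)=\chi(x') \iff x\equiv_f x'$ for all $x,x'$; (e) there is $\rho$ such that $\rho(e)\equiv_f\rho(e') \Rightarrow \rho(e)=\rho(e')$ for all $e,e'$, and for every $x$ there is $e$ with $x\equiv_f \rho(e)$. Moreover, these functions are pairwise computationally equivalent (each can be computed from any other, together with $f$).
   Context: $x\equiv_f x'$ means $x' = f^k(x)$ for some $k\in\mathbb{Z}$. $[p]$ denotes the truth value (coded as a natural number) of predicate $p$. *)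

theory Defs
  imports Main
begin

text \<open>
  Kleene's partial recursive functions relative to a list of oracles, as programs. A function of
  arity \<open>k\<close> acts on argument lists of length \<open>k\<close>; \<^term>\<open>None\<close> means that the
  computation diverges or that the arities do not fit. \<open>Mu p\<close> searches for the least zero of
  \<open>p\<close> in its first argument, which requires \<open>p\<close> to be defined on all smaller arguments.
\<close>

datatype prog =
    Zero
  | Succ
  | Proj nat
  | Comp prog "prog list"
  | PrimRec prog prog
  | Mu prog
  | Oracle nat

fun eval :: "(nat list \<Rightarrow> nat option) list \<Rightarrow> prog \<Rightarrow> nat list \<Rightarrow> nat option" where
  "eval \<Omega> Zero xs = Some 0"
| "eval \<Omega> Succ xs = (case xs of [x] \<Rightarrow> Some (Suc x) | _ \<Rightarrow> None)"
| "eval \<Omega> (Proj i) xs = (if i < length xs then Some (xs ! i) else None)"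
| "eval \<Omega> (Comp p qs) xs =
     Option.bind (those (map (\<lambda>q. eval \<Omega> q xs) qs)) (\<lambda>ys. eval \<Omega> p ys)"
| "eval \<Omega> (PrimRec p q) xs =
     (case xs of
        [] \<Rightarrow> None
      | n # ys \<Rightarrow>
          rec_nat (eval \<Omega> p ys) (\<lambda>k r. Option.bind r (\<lambda>y. eval \<Omega> q (k # y # ys))) n)"
| "eval \<Omega> (Mu p) xs =
     (if \<exists>n. eval \<Omega> p (n # xs) = Some 0 \<and> (\<forall>m<n. eval \<Omega> p (m # xs) \<noteq> None)
      then Some (LEAST n. eval \<Omega> p (n # xs) = Some 0)
      else None)"
| "eval \<Omega> (Oracle i) xs = (if i < length \<Omega> then (\<Omega> ! i) xs else None)"

definition oracle1 :: "(nat \<Rightarrow> nat) \<Rightarrow> nat list \<Rightarrow> nat option" where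
  "oracle1 g xs = (case xs of [x] \<Rightarrow> Some (g x) | _ \<Rightarrow> None)"

definition oracle2 :: "(nat \<Rightarrow> nat \<Rightarrow> nat) \<Rightarrow> nat list \<Rightarrow> nat option" where
  "oracle2 g xs = (case xs of [x, y] \<Rightarrow> Some (g x y) | _ \<Rightarrow> None)"

definition computes1 :: "(nat list \<Rightarrow> nat option) list \<Rightarrow> prog \<Rightarrow> (nat \<Rightarrow> nat) \<Rightarrow> bool" where
  "computes1 \<Omega> p g \<longleftrightarrow> (\<forall>x. eval \<Omega> p [x] = Some (g x))"

definition computes2 :: "(nat list \<Rightarrow> nat option) list \<Rightarrow> prog \<Rightarrow> (nat \<Rightarrow> nat \<Rightarrow> nat) \<Rightarrow> bool" where
  "computes2 \<Omega> p g \<longleftrightarrow> (\<forall>x y. eval \<Omega> p [x, y] = Some (g x y))"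

definition recursive1 :: "(nat \<Rightarrow> nat) \<Rightarrow> bool" where
  "recursive1 g \<longleftrightarrow> (\<exists>p. computes1 [] p g)"

definition recursive2 :: "(nat \<Rightarrow> nat \<Rightarrow> nat) \<Rightarrow> bool" where
  "recursive2 g \<longleftrightarrow> (\<exists>p. computes2 [] p g)"

definition recursive_permutation :: "(nat \<Rightarrow> nat) \<Rightarrow> bool" where
  "recursive_permutation f \<longleftrightarrow> recursive1 f \<and> bij f"

definition int_iter :: "('a \<Rightarrow> 'a) \<Rightarrow> int \<Rightarrow> 'a \<Rightarrow> 'a" where
  "int_iter f k = (if k \<ge> 0 then f ^^ nat k else inv f ^^ nat (- k))"

definition cyc_equiv :: "('a \<Rightarrow> 'a) \<Rightarrow> 'a \<Rightarrow> 'a \<Rightarrow> bool" where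
  "cyc_equiv f x x' \<longleftrightarrow> (\<exists>k. x' = int_iter f k x)"

definition cycle_decider :: "(nat \<Rightarrow> nat) \<Rightarrow> (nat \<Rightarrow> nat \<Rightarrow> nat) \<Rightarrow> bool" where
  "cycle_decider f \<pi> \<longleftrightarrow> (\<forall>x x'. \<pi> x x' = of_bool (cyc_equiv f x x'))"

definition cycle_minimum :: "(nat \<Rightarrow> nat) \<Rightarrow> (nat \<Rightarrow> nat) \<Rightarrow> bool" where
  "cycle_minimum f \<mu> \<longleftrightarrow> (\<forall>x. \<mu> x = (LEAST x'. cyc_equiv f x x'))"

definition cycle_representative :: "(nat \<Rightarrow> nat) \<Rightarrow> (nat \<Rightarrow> nat) \<Rightarrow> bool" where
  "cycle_representative f \<theta> \<longleftrightarrow>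
     (\<forall>x x'. cyc_equiv f x x' \<longrightarrow> \<theta> x = \<theta> x') \<and> (\<forall>x. cyc_equiv f (\<theta> x) x)"

definition cycle_invariant :: "(nat \<Rightarrow> nat) \<Rightarrow> (nat \<Rightarrow> nat) \<Rightarrow> bool" where
  "cycle_invariant f \<chi> \<longleftrightarrow> (\<forall>x x'. \<chi> x = \<chi> x' \<longleftrightarrow> cyc_equiv f x x')"

definition cycle_enumerator :: "(nat \<Rightarrow> nat) \<Rightarrow> (nat \<Rightarrow> nat) \<Rightarrow> bool" where
  "cycle_enumerator f \<rho> \<longleftrightarrow>
     (\<forall>e e'. cyc_equiv f (\<rho> e) (\<rho> e') \<longrightarrow> \<rho> e = \<rho> e') \<and> (\<forall>x. \<exists>e. cyc_equiv f x (\<rho> e))"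

text \<open>
  Uniform computability of functions solving one problem from arbitrary functions solving another,
  together with \<open>f\<close>: a single program works for all recursive permutations \<open>f\<close> and all
  solutions \<open>g\<close>, having only oracle access to both. The given \<open>g\<close> is not required to be
  recursive; if it is, so is the computed \<open>h\<close>. Without uniformity, computability of one recursive
  function from another would be vacuous. The digits give the arities of \<open>g\<close> and \<open>h\<close>.
\<close>

definition computable_from11 ::
  "((nat \<Rightarrow> nat) \<Rightarrow> (nat \<Rightarrow> nat) \<Rightarrow> bool) \<Rightarrow> ((nat \<Rightarrow> nat) \<Rightarrow> (nat \<Rightarrow> nat) \<Rightarrow> bool) \<Rightarrow> bool" where
  "computable_from11 S T \<longleftrightarrow>
     (\<exists>p. \<forall>f g. recursive_permutation f \<and> S f g \<longrightarrow>
        (\<exists>h. computes1 [oracle1 f, oracle1 g] p h \<and> T f h))"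

definition computable_from12 ::
  "((nat \<Rightarrow> nat) \<Rightarrow> (nat \<Rightarrow> nat) \<Rightarrow> bool) \<Rightarrow> ((nat \<Rightarrow> nat) \<Rightarrow> (nat \<Rightarrow> nat \<Rightarrow> nat) \<Rightarrow> bool) \<Rightarrow> bool" where
  "computable_from12 S T \<longleftrightarrow>
     (\<exists>p. \<forall>f g. recursive_permutation f \<and> S f g \<longrightarrow>
        (\<exists>h. computes2 [oracle1 f, oracle1 g] p h \<and> T f h))"

definition computable_from21 ::
  "((nat \<Rightarrow> nat) \<Rightarrow> (nat \<Rightarrow> nat \<Rightarrow> nat) \<Rightarrow> bool) \<Rightarrow> ((nat \<Rightarrow> nat) \<Rightarrow> (nat \<Rightarrow> nat) \<Rightarrow> bool) \<Rightarrow> bool" where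
  "computable_from21 S T \<longleftrightarrow>
     (\<exists>p. \<forall>f g. recursive_permutation f \<and> S f g \<longrightarrow>
        (\<exists>h. computes1 [oracle1 f, oracle2 g] p h \<and> T f h))"

end

theory Submission
  imports Defs
begin

text \<open>
  All implications are witnessed by oracle programs that are uniform in \<open>f\<close>. A cycle minimum is a
  representative, and a representative is both an invariant and an enumerator. Comparing invariants
  decides \<open>\<equiv>\<^sub>f\<close>, and a decider yields the minimum by unbounded search. For the one remaining step,
  from an enumerator \<open>\<rho>\<close> to a representative, dovetail over \<open>e\<close> and \<open>j\<close> until
  \<open>f\<^sup>j x = \<rho> e\<close> or \<open>f\<^sup>j (\<rho> e) = x\<close>, and return \<open>\<rho> e\<close>; this never needs \<open>f\<close> inverted. Substituting
  programs for oracles composes such reductions, and replacing the oracles by oracle-free programs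
  gives the equivalence of the recursive versions.
\<close>

section \<open>The equivalence relation of a permutation\<close>

text \<open>A negative iterate from \<open>x\<close> to \<open>y\<close> is a forward iterate from
  \<open>y\<close> to \<open>x\<close>. Only forward iterates remain, and programs can compute these
  from \<open>f\<close> alone.\<close>

lemma cyc_equiv_iff:
  assumes "bij f"
  shows "cyc_equiv f x y \<longleftrightarrow> (\<exists>n. (f ^^ n) x = y \<or> (f ^^ n) y = x)"
proof -
  have inv: "y = (inv f ^^ n) x \<longleftrightarrow> (f ^^ n) y = x" for n
    using assms by (metis bij_fn bij_inv_eq_iff inv_fn)
  show ?thesis
  proof
    assume "cyc_equiv f x y"
    then show "\<exists>n. (f ^^ n) x = y \<or> (f ^^ n) y = x"
      unfolding cyc_equiv_def int_iter_def by (metis inv)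
  next
    assume "\<exists>n. (f ^^ n) x = y \<or> (f ^^ n) y = x"
    then obtain n where "(f ^^ n) x = y \<or> (f ^^ n) y = x" ..
    then have "y = int_iter f (int n) x \<or> y = int_iter f (- int n) x"
      by (auto simp: int_iter_def inv)
    then show "cyc_equiv f x y"
      unfolding cyc_equiv_def by blast
  qed
qed

lemma cyc_equiv_refl: "cyc_equiv f x x"
  unfolding cyc_equiv_def by (rule exI[of _ 0]) (simp add: int_iter_def)

lemma cyc_equiv_sym: "bij f \<Longrightarrow> cyc_equiv f x y \<Longrightarrow> cyc_equiv f y x"
  by (auto simp: cyc_equiv_iff)

lemma cyc_equiv_trans:
  assumes "bij f" "cyc_equiv f x y" "cyc_equiv f y z"
  shows "cyc_equiv f x z"
proof -
  have inj: "(f ^^ n) a = (f ^^ n) b \<longleftrightarrow> a = b" for n a b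
    using bij_fn[OF assms(1), of n] by (simp add: bij_def inj_eq)
  have split: "(f ^^ n) a = (f ^^ m) ((f ^^ (n - m)) a)" if "m \<le> n" for m n a
    using that by (metis comp_apply funpow_add le_add_diff_inverse)
  obtain m n where m: "(f ^^ m) x = y \<or> (f ^^ m) y = x" and n: "(f ^^ n) y = z \<or> (f ^^ n) z = y"
    using assms by (auto simp: cyc_equiv_iff)
  have "\<exists>k. (f ^^ k) x = z \<or> (f ^^ k) z = x"
    using m n
  proof (elim disjE)
    assume "(f ^^ m) x = y" "(f ^^ n) y = z"
    then have "(f ^^ (n + m)) x = z" by (simp add: funpow_add)
    then show ?thesis by blast
  next
    assume "(f ^^ m) y = x" "(f ^^ n) z = y"
    then have "(f ^^ (m + n)) z = x" by (simp add: funpow_add)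
    then show ?thesis by blast
  next
    \<comment> \<open>Two paths end in \<open>y\<close>: the shorter one is cancelled from the
      longer by injectivity.\<close>
    assume eq: "(f ^^ m) x = y" "(f ^^ n) z = y"
    show ?thesis
      using split[of m n z] split[of n m x] eq by (metis inj nat_le_linear)
  next
    \<comment> \<open>Two paths start in \<open>y\<close>: the longer one passes through the end of
      the shorter.\<close>
    assume eq: "(f ^^ m) y = x" "(f ^^ n) y = z"
    have "(f ^^ n) y = (f ^^ (n - m)) x" if "m \<le> n"
      using that eq by (metis comp_apply funpow_add le_add_diff_inverse2)
    moreover have "(f ^^ m) y = (f ^^ (m - n)) z" if "n \<le> m"
      using that eq by (metis comp_apply funpow_add le_add_diff_inverse2)
    ultimately show ?thesis
      using eq by (metis nat_le_linear)
  qed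
  then show ?thesis
    using assms(1) by (simp add: cyc_equiv_iff)
qed

section \<open>Set-theoretic implications between the conditions\<close>

lemma cycle_minimum_imp_representative:
  assumes "bij f" "cycle_minimum f \<mu>"
  shows "cycle_representative f \<mu>"
  unfolding cycle_representative_def
proof (intro conjI allI impI)
  fix x x' assume "cyc_equiv f x x'"
  then have "cyc_equiv f x = cyc_equiv f x'"
    using assms(1) by (blast intro: cyc_equiv_sym cyc_equiv_trans)
  then show "\<mu> x = \<mu> x'"
    using assms(2) by (simp add: cycle_minimum_def)
next
  fix x
  have "cyc_equiv f x (\<mu> x)"
    using assms(2) LeastI[of "cyc_equiv f x", OF cyc_equiv_refl] by (simp add: cycle_minimum_def)
  then show "cyc_equiv f (\<mu> x) x"
    by (rule cyc_equiv_sym[OF assms(1)])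
qed

lemma cycle_representative_imp_invariant:
  "bij f \<Longrightarrow> cycle_representative f \<theta> \<Longrightarrow> cycle_invariant f \<theta>"
  unfolding cycle_representative_def cycle_invariant_def
  by (metis cyc_equiv_sym cyc_equiv_trans)

text \<open>Points serve as indices: if \<open>\<theta> e\<close> and \<open>\<theta> e'\<close> are
  equivalent, so are \<open>e\<close> and \<open>e'\<close>, which therefore share their
  representative.\<close>

lemma cycle_representative_imp_enumerator:
  "bij f \<Longrightarrow> cycle_representative f \<theta> \<Longrightarrow> cycle_enumerator f \<theta>"
  unfolding cycle_representative_def cycle_enumerator_def
  by (metis cyc_equiv_sym cyc_equiv_trans)

text \<open>For equivalent points the selected values of \<open>\<rho>\<close> are equivalent, hence
  equal, even if \<open>s\<close> selects different indices.\<close>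

lemma cycle_enumerator_imp_representative:
  assumes "bij f" "cycle_enumerator f \<rho>" "\<And>x. cyc_equiv f x (\<rho> (s x))"
  shows "cycle_representative f (\<lambda>x. \<rho> (s x))"
  using assms unfolding cycle_representative_def cycle_enumerator_def
  by (metis cyc_equiv_sym cyc_equiv_trans)

section \<open>Substituting programs for oracles\<close>

fun subst_oracles :: "prog list \<Rightarrow> prog \<Rightarrow> prog" where
  "subst_oracles rs Zero = Zero"
| "subst_oracles rs Succ = Succ"
| "subst_oracles rs (Proj i) = Proj i"
| "subst_oracles rs (Comp p qs) = Comp (subst_oracles rs p) (map (subst_oracles rs) qs)"
| "subst_oracles rs (PrimRec p q) = PrimRec (subst_oracles rs p) (subst_oracles rs q)"
| "subst_oracles rs (Mu p) = Mu (subst_oracles rs p)"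
| "subst_oracles rs (Oracle i) = rs ! i"

text \<open>Asking for successor values below \<open>n\<close> combines definedness with being
  nonzero, a form that survives enlarging the graph of \<open>p\<close>.\<close>

lemma eval_Mu_eqI:
  assumes "eval \<Omega> p (n # xs) = Some 0"
    and "\<And>m. m < n \<Longrightarrow> \<exists>v. eval \<Omega> p (m # xs) = Some (Suc v)"
  shows "eval \<Omega> (Mu p) xs = Some n"
proof -
  have "(LEAST n. eval \<Omega> p (n # xs) = Some 0) = n"
  proof (rule Least_equality)
    show "n \<le> m" if "eval \<Omega> p (m # xs) = Some 0" for m
      using assms(2)[of m] that by fastforce
  qed (rule assms(1))
  moreover have "\<forall>m<n. eval \<Omega> p (m # xs) \<noteq> None"
    using assms(2) by fastforce
  ultimately show ?thesis
    using assms(1) by auto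
qed

lemma eval_Mu_SomeD:
  assumes "eval \<Omega> (Mu p) xs = Some n"
  shows "eval \<Omega> p (n # xs) = Some 0"
    and "m < n \<Longrightarrow> \<exists>v. eval \<Omega> p (m # xs) = Some (Suc v)"
proof -
  from assms obtain k where k: "eval \<Omega> p (k # xs) = Some 0" "\<forall>m<k. eval \<Omega> p (m # xs) \<noteq> None"
    and n: "n = (LEAST n. eval \<Omega> p (n # xs) = Some 0)"
    by (auto split: if_splits)
  show "eval \<Omega> p (n # xs) = Some 0"
    unfolding n using k(1) by (rule LeastI)
  \<comment> \<open>Definedness is known only below \<open>k\<close>, so the least zero must not
    exceed it.\<close>
  have "n \<le> k"
    unfolding n using k(1) by (rule Least_le)
  show "\<exists>v. eval \<Omega> p (m # xs) = Some (Suc v)" if "m < n"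
  proof -
    have "eval \<Omega> p (m # xs) \<noteq> None"
      using k(2) that \<open>n \<le> k\<close> by simp
    moreover have "eval \<Omega> p (m # xs) \<noteq> Some 0"
      using that unfolding n by (rule not_less_Least)
    ultimately show ?thesis
      by (metis not0_implies_Suc option.exhaust)
  qed
qed

text \<open>
  Only inclusion of graphs holds here: a substituted program may be defined on argument lists of a
  length on which the oracle is undefined.
\<close>

lemma eval_subst_oracles:
  assumes "\<And>i xs v. i < length \<Omega> \<Longrightarrow> (\<Omega> ! i) xs = Some v \<Longrightarrow> eval \<Omega>' (rs ! i) xs = Some v"
  shows "eval \<Omega> p xs = Some v \<Longrightarrow> eval \<Omega>' (subst_oracles rs p) xs = Some v"
proof (induction p arbitrary: xs v)
  case (Comp p qs)
  then obtain ys where ys: "those (map (\<lambda>q. eval \<Omega> q xs) qs) = Some ys" and v: "eval \<Omega> p ys = Some v"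
    by (auto simp: bind_eq_Some_conv)
  have "those (map (\<lambda>q. eval \<Omega>' q xs) (map (subst_oracles rs) qs)) = Some ys"
    using ys Comp.IH(2)
  proof (induction qs arbitrary: ys)
    case (Cons q qs)
    then show ?case
      by (auto split: option.splits)
  qed simp
  then show ?case
    using Comp.IH(1)[OF v] by simp
next
  case (PrimRec p q)
  then obtain n ys where xs: "xs = n # ys"
    by (cases xs) auto
  \<comment> \<open>Inner induction on the recursion counter, with \<open>v\<close> general because
    the intermediate values vary.\<close>
  have "rec_nat (eval \<Omega> p ys) (\<lambda>k r. Option.bind r (\<lambda>y. eval \<Omega> q (k # y # ys))) n = Some v \<Longrightarrow>
    rec_nat (eval \<Omega>' (subst_oracles rs p) ys)
      (\<lambda>k r. Option.bind r (\<lambda>y. eval \<Omega>' (subst_oracles rs q) (k # y # ys))) n = Some v"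
    by (induction n arbitrary: v) (auto simp: bind_eq_Some_conv PrimRec.IH)
  then show ?case
    using PrimRec.prems xs by simp
next
  case (Mu p)
  show ?case
    unfolding subst_oracles.simps
    using eval_Mu_SomeD[OF Mu.prems] Mu.IH by (intro eval_Mu_eqI) blast+
next
  case (Oracle i)
  then show ?case
    using assms by (auto split: if_splits)
qed (auto split: list.splits if_splits)

section \<open>Reductions between problems\<close>

text \<open>Functions of either arity are treated alike as oracles.\<close>

type_synonym problem = "(nat \<Rightarrow> nat) \<Rightarrow> (nat list \<Rightarrow> nat option) \<Rightarrow> bool"

definition problem1 :: "((nat \<Rightarrow> nat) \<Rightarrow> (nat \<Rightarrow> nat) \<Rightarrow> bool) \<Rightarrow> problem" where
  "problem1 S f G \<longleftrightarrow> (\<exists>g. G = oracle1 g \<and> S f g)"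

definition problem2 :: "((nat \<Rightarrow> nat) \<Rightarrow> (nat \<Rightarrow> nat \<Rightarrow> nat) \<Rightarrow> bool) \<Rightarrow> problem" where
  "problem2 S f G \<longleftrightarrow> (\<exists>g. G = oracle2 g \<and> S f g)"

text \<open>Graph inclusion leaves argument lists of the wrong length unconstrained, just as
  \<open>computes1\<close> and \<open>computes2\<close> do.\<close>

definition extends :: "(nat list \<Rightarrow> nat option) list \<Rightarrow> prog \<Rightarrow> (nat list \<Rightarrow> nat option) \<Rightarrow> bool" where
  "extends \<Omega> p H \<longleftrightarrow> (\<forall>xs v. H xs = Some v \<longrightarrow> eval \<Omega> p xs = Some v)"

text \<open>The problem to be solved comes first, opposite to the \<open>computable_from\<close>
  order, so that chains read as reductions.\<close>

definition reducible :: "problem \<Rightarrow> problem \<Rightarrow> bool" where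
  "reducible T S \<longleftrightarrow>
     (\<exists>p. \<forall>f G. recursive_permutation f \<and> S f G \<longrightarrow> (\<exists>H. extends [oracle1 f, G] p H \<and> T f H))"

lemma computes1_iff_extends: "computes1 \<Omega> p g \<longleftrightarrow> extends \<Omega> p (oracle1 g)"
  by (auto simp: computes1_def extends_def oracle1_def split: list.splits)

lemma computes2_iff_extends: "computes2 \<Omega> p g \<longleftrightarrow> extends \<Omega> p (oracle2 g)"
  by (auto simp: computes2_def extends_def oracle2_def split: list.splits)

lemma computable_from11_iff: "computable_from11 S T \<longleftrightarrow> reducible (problem1 T) (problem1 S)"
  unfolding computable_from11_def reducible_def problem1_def computes1_iff_extends by metis

lemma computable_from12_iff: "computable_from12 S T \<longleftrightarrow> reducible (problem2 T) (problem1 S)"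
  unfolding computable_from12_def reducible_def problem1_def problem2_def computes2_iff_extends
  by metis

lemma computable_from21_iff: "computable_from21 S T \<longleftrightarrow> reducible (problem1 T) (problem2 S)"
  unfolding computable_from21_def reducible_def problem1_def problem2_def computes1_iff_extends
  by metis

lemma extends_subst_oracles:
  assumes "extends [F, G] p H" "extends \<Omega> q F" "extends \<Omega> r G"
  shows "extends \<Omega> (subst_oracles [q, r] p) H"
  unfolding extends_def
proof (intro allI impI)
  fix xs v assume "H xs = Some v"
  then have "eval [F, G] p xs = Some v"
    using assms(1) by (simp add: extends_def)
  then show "eval \<Omega> (subst_oracles [q, r] p) xs = Some v"
  proof (rule eval_subst_oracles[rotated])
    fix i xs v assume "i < length [F, G]" "([F, G] ! i) xs = Some v"
    then show "eval \<Omega> ([q, r] ! i) xs = Some v"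
      using assms(2,3) by (cases i) (auto simp: extends_def)
  qed
qed

lemma extends_Oracle: "i < length \<Omega> \<Longrightarrow> extends \<Omega> (Oracle i) (\<Omega> ! i)"
  by (simp add: extends_def)

lemma reducible_trans [trans]:
  assumes "reducible U T" "reducible T S"
  shows "reducible U S"
proof -
  obtain p where p: "recursive_permutation f \<Longrightarrow> T f G \<Longrightarrow> \<exists>H. extends [oracle1 f, G] p H \<and> U f H"
    for f G using assms(1) unfolding reducible_def by blast
  obtain q where q: "recursive_permutation f \<Longrightarrow> S f G \<Longrightarrow> \<exists>H. extends [oracle1 f, G] q H \<and> T f H"
    for f G using assms(2) unfolding reducible_def by blast
  \<comment> \<open>\<open>Oracle 0\<close> keeps the access to \<open>f\<close>, while
    \<open>q\<close> answers the queries that \<open>p\<close> makes to a solution of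
    \<open>T\<close>.\<close>
  have "\<exists>H. extends [oracle1 f, G] (subst_oracles [Oracle 0, q] p) H \<and> U f H"
    if f: "recursive_permutation f" and G: "S f G" for f G
  proof -
    obtain K where K: "extends [oracle1 f, G] q K" "T f K"
      using q[OF f G] by blast
    obtain H where H: "extends [oracle1 f, K] p H" "U f H"
      using p[OF f K(2)] by blast
    show ?thesis
      using extends_subst_oracles[OF H(1) _ K(1)] extends_Oracle[of 0 "[oracle1 f, G]"] H(2) by auto
  qed
  then show ?thesis
    unfolding reducible_def by blast
qed

lemma reducible_problem1I:
  assumes "\<And>f g. bij f \<Longrightarrow> S f g \<Longrightarrow> T f g"
  shows "reducible (problem1 T) (problem1 S)"
proof -
  have "\<exists>H. extends [oracle1 f, G] (Oracle 1) H \<and> problem1 T f H"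
    if "recursive_permutation f" "problem1 S f G" for f G
    using extends_Oracle[of 1 "[oracle1 f, G]"] assms that
    by (auto simp: problem1_def recursive_permutation_def)
  then show ?thesis
    unfolding reducible_def by blast
qed

definition recursively_solvable :: "problem \<Rightarrow> (nat \<Rightarrow> nat) \<Rightarrow> bool" where
  "recursively_solvable S f \<longleftrightarrow> (\<exists>G p. extends [] p G \<and> S f G)"

lemma recursively_solvable_problem1:
  "recursively_solvable (problem1 S) f \<longleftrightarrow> (\<exists>g. recursive1 g \<and> S f g)"
  unfolding recursively_solvable_def problem1_def recursive1_def computes1_iff_extends by metis

lemma recursively_solvable_problem2:
  "recursively_solvable (problem2 S) f \<longleftrightarrow> (\<exists>g. recursive2 g \<and> S f g)"
  unfolding recursively_solvable_def problem2_def recursive2_def computes2_iff_extends by metis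

text \<open>Oracle-free programs for \<open>f\<close> and for a solution of \<open>S\<close> replace
  both oracles of the uniform program.\<close>

lemma recursively_solvable_reducible:
  assumes "reducible T S" "recursive_permutation f" "recursively_solvable S f"
  shows "recursively_solvable T f"
proof -
  obtain q where q: "extends [] q (oracle1 f)"
    using assms(2) by (auto simp: recursive_permutation_def recursive1_def computes1_iff_extends)
  obtain G r where r: "extends [] r G" and G: "S f G"
    using assms(3) by (auto simp: recursively_solvable_def)
  obtain p H where "extends [oracle1 f, G] p H" and "T f H"
    using assms(1,2) G unfolding reducible_def by blast
  then show ?thesis
    using extends_subst_oracles q r unfolding recursively_solvable_def by blast
qed

section \<open>Programs\<close>

text \<open>In a step program \<open>Proj 0\<close> is the counter, \<open>Proj 1\<close> the
  previous value, and the parameters start at \<open>Proj 2\<close>.\<close>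

lemma eval_PrimRecI:
  assumes "eval \<Omega> p ys = Some (g 0)" "\<And>k. eval \<Omega> q (k # g k # ys) = Some (g (Suc k))"
  shows "eval \<Omega> (PrimRec p q) (n # ys) = Some (g n)"
  by (induction n) (simp_all add: assms)

lemma eval_MuI:
  assumes "\<And>n. eval \<Omega> p (n # xs) = Some (g n)" "\<exists>n. g n = 0"
  shows "eval \<Omega> (Mu p) xs = Some (LEAST n. g n = 0)"
proof (rule eval_Mu_eqI)
  show "eval \<Omega> p ((LEAST n. g n = 0) # xs) = Some 0"
    using assms(1) LeastI_ex[OF assms(2)] by simp
  show "\<exists>v. eval \<Omega> p (m # xs) = Some (Suc v)" if "m < (LEAST n. g n = 0)" for m
    using assms(1) not_less_Least[OF that] by (auto simp: gr0_conv_Suc)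
qed

declare eval.simps(5,6) [simp del]

definition is_zero_prog :: prog where
  "is_zero_prog = PrimRec (Comp Succ [Zero]) Zero"

lemma eval_is_zero_prog [simp]: "eval \<Omega> is_zero_prog [n] = Some (of_bool (n = 0))"
  unfolding is_zero_prog_def by (rule eval_PrimRecI) auto

definition pred_prog :: prog where
  "pred_prog = PrimRec Zero (Proj 0)"

lemma eval_pred_prog [simp]: "eval \<Omega> pred_prog [n] = Some (n - 1)"
  unfolding pred_prog_def by (rule eval_PrimRecI) auto

definition add_prog :: prog where
  "add_prog = PrimRec (Proj 0) (Comp Succ [Proj 1])"

lemma eval_add_prog [simp]: "eval \<Omega> add_prog [m, n] = Some (m + n)"
  unfolding add_prog_def by (rule eval_PrimRecI) auto

definition mult_prog :: prog where
  "mult_prog = PrimRec Zero (Comp add_prog [Proj 1, Proj 2])"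

lemma eval_mult_prog [simp]: "eval \<Omega> mult_prog [m, n] = Some (m * n)"
  unfolding mult_prog_def by (rule eval_PrimRecI) auto

text \<open>Recursion runs on the first argument, so the subtrahend comes first.\<close>

definition diff_prog :: prog where
  "diff_prog = PrimRec (Proj 0) (Comp pred_prog [Proj 1])"

lemma eval_diff_prog [simp]: "eval \<Omega> diff_prog [m, n] = Some (n - m)"
  unfolding diff_prog_def by (rule eval_PrimRecI) auto

definition dist_prog :: prog where
  "dist_prog = Comp add_prog [Comp diff_prog [Proj 0, Proj 1], Comp diff_prog [Proj 1, Proj 0]]"

text \<open>The absolute difference: at most one of the two truncated differences is
  nonzero.\<close>

definition nat_dist :: "nat \<Rightarrow> nat \<Rightarrow> nat" where
  "nat_dist m n = (n - m) + (m - n)"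

lemma nat_dist_eq_0_iff [simp]: "nat_dist m n = 0 \<longleftrightarrow> m = n"
  by (auto simp: nat_dist_def)

lemma eval_dist_prog [simp]: "eval \<Omega> dist_prog [m, n] = Some (nat_dist m n)"
  by (simp add: dist_prog_def nat_dist_def)

definition iter_prog :: prog where
  "iter_prog = PrimRec (Proj 0) (Comp (Oracle 0) [Proj 1])"

lemma eval_iter_prog [simp]: "eval [oracle1 f, G] iter_prog [n, x] = Some ((f ^^ n) x)"
  unfolding iter_prog_def by (rule eval_PrimRecI) (auto simp: oracle1_def)

section \<open>Reductions between the five problems\<close>

lemma reducible_decider_invariant:
  "reducible (problem2 cycle_decider) (problem1 cycle_invariant)"
proof -
  let ?p = "Comp is_zero_prog [Comp dist_prog [Comp (Oracle 1) [Proj 0], Comp (Oracle 1) [Proj 1]]]"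
  have "computes2 [oracle1 f, oracle1 \<chi>] ?p (\<lambda>x y. of_bool (\<chi> x = \<chi> y))" for f \<chi>
    by (auto simp: computes2_def oracle1_def)
  moreover have "cycle_decider f (\<lambda>x y. of_bool (\<chi> x = \<chi> y))" if "cycle_invariant f \<chi>" for f \<chi>
    using that by (simp add: cycle_decider_def cycle_invariant_def)
  ultimately show ?thesis
    unfolding computable_from12_iff[symmetric] computable_from12_def by blast
qed

lemma reducible_minimum_decider:
  "reducible (problem1 cycle_minimum) (problem2 cycle_decider)"
proof -
  \<comment> \<open>\<open>Mu\<close> seeks a zero but the decider signals success by 1, hence the
    negation. \<open>Proj 0\<close> is the candidate, \<open>Proj 1\<close> the input.\<close>
  let ?p = "Mu (Comp is_zero_prog [Comp (Oracle 1) [Proj 1, Proj 0]])"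
  have "computes1 [oracle1 f, oracle2 \<pi>] ?p (\<lambda>x. LEAST y. cyc_equiv f x y)"
    if \<pi>: "cycle_decider f \<pi>" for f \<pi>
    unfolding computes1_def
  proof
    fix x
    have "eval [oracle1 f, oracle2 \<pi>] ?p [x] = Some (LEAST y. (of_bool (\<not> cyc_equiv f x y) :: nat) = 0)"
      \<comment> \<open>The search terminates because \<open>x\<close> itself is a
        candidate.\<close>
      using \<pi> by (intro eval_MuI) (auto simp: oracle2_def cycle_decider_def intro: cyc_equiv_refl)
    then show "eval [oracle1 f, oracle2 \<pi>] ?p [x] = Some (LEAST y. cyc_equiv f x y)"
      by simp
  qed
  moreover have "cycle_minimum f (\<lambda>x. LEAST y. cyc_equiv f x y)" for f
    by (simp add: cycle_minimum_def)
  ultimately show ?thesis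
    unfolding computable_from21_iff[symmetric] computable_from21_def by blast
qed

text \<open>
  Conditions are coded by their zeros, so that products express disjunction and bounded existential
  quantification. \<open>near_prog\<close> takes arguments \<open>[n, e, x]\<close> and \<open>search_prog\<close> takes \<open>[n, m, x]\<close>.
\<close>

definition near :: "(nat \<Rightarrow> nat) \<Rightarrow> (nat \<Rightarrow> nat) \<Rightarrow> nat \<Rightarrow> nat \<Rightarrow> nat \<Rightarrow> nat" where
  "near f \<rho> n e x = (\<Prod>j<n. nat_dist ((f ^^ j) x) (\<rho> e) * nat_dist ((f ^^ j) (\<rho> e)) x)"

lemma near_eq_0_iff:
  "near f \<rho> n e x = 0 \<longleftrightarrow> (\<exists>j<n. (f ^^ j) x = \<rho> e \<or> (f ^^ j) (\<rho> e) = x)"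
  by (auto simp: near_def)

definition near_prog :: prog where
  "near_prog = PrimRec (Comp Succ [Zero])
     (Comp mult_prog [Proj 1, Comp mult_prog
        [Comp dist_prog [Comp iter_prog [Proj 0, Proj 3], Comp (Oracle 1) [Proj 2]],
         Comp dist_prog [Comp iter_prog [Proj 0, Comp (Oracle 1) [Proj 2]], Proj 3]]])"

lemma eval_near_prog [simp]:
  "eval [oracle1 f, oracle1 \<rho>] near_prog [n, e, x] = Some (near f \<rho> n e x)"
  unfolding near_prog_def by (rule eval_PrimRecI) (auto simp: near_def oracle1_def numeral_3_eq_3)

definition search_prog :: prog where
  "search_prog = PrimRec (Comp Succ [Zero])
     (Comp mult_prog [Proj 1, Comp near_prog [Proj 2, Proj 0, Proj 3]])"

lemma eval_search_prog [simp]: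
  "eval [oracle1 f, oracle1 \<rho>] search_prog [n, m, x] = Some (\<Prod>e<n. near f \<rho> m e x)"
  unfolding search_prog_def by (rule eval_PrimRecI) (auto simp: numeral_3_eq_3)

lemma reducible_representative_enumerator:
  "reducible (problem1 cycle_representative) (problem1 cycle_enumerator)"
proof -
  \<comment> \<open>A single number bounds both the index and the iteration count, so one unbounded
    search dovetails over both. With that bound fixed, \<open>?e\<close> recovers the index.\<close>
  let ?b = "Mu (Comp search_prog [Proj 0, Proj 0, Proj 1])"
  let ?e = "Mu (Comp near_prog [Proj 1, Proj 0, Proj 2])"
  let ?p = "Comp (Oracle 1) [Comp ?e [?b, Proj 0]]"
  have "\<exists>h. computes1 [oracle1 f, oracle1 \<rho>] ?p h \<and> cycle_representative f h"
    if f: "bij f" and \<rho>: "cycle_enumerator f \<rho>" for f \<rho>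
  proof -
    define b where "b x = (LEAST n. (\<Prod>e<n. near f \<rho> n e x) = 0)" for x
    define s where "s x = (LEAST e. near f \<rho> (b x) e x = 0)" for x
    have ex_b: "\<exists>n. (\<Prod>e<n. near f \<rho> n e x) = 0" for x
    proof -
      obtain e j where ej: "(f ^^ j) x = \<rho> e \<or> (f ^^ j) (\<rho> e) = x"
        using \<rho> f by (metis cycle_enumerator_def cyc_equiv_iff)
      \<comment> \<open>Both bounds are strict, hence the successor.\<close>
      let ?n = "Suc (max e j)"
      have "near f \<rho> ?n e x = 0"
        unfolding near_eq_0_iff using ej by (intro exI[of _ j]) simp
      moreover have "e < ?n" by simp
      ultimately have "(\<Prod>e<?n. near f \<rho> ?n e x) = 0"
        by (intro prod_zero) blast+
      then show ?thesis ..
    qed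
    have ex_s: "\<exists>e. near f \<rho> (b x) e x = 0" for x
      \<comment> \<open>A vanishing product has a vanishing factor, so the second search terminates
        too.\<close>
      using LeastI_ex[OF ex_b[of x]] unfolding b_def[symmetric] by auto
    have "near f \<rho> (b x) (s x) x = 0" for x
      unfolding s_def by (rule LeastI_ex[OF ex_s])
    then have "cyc_equiv f x (\<rho> (s x))" for x
      unfolding cyc_equiv_iff[OF f] near_eq_0_iff by blast
    then have "cycle_representative f (\<lambda>x. \<rho> (s x))"
      by (rule cycle_enumerator_imp_representative[OF f \<rho>])
    moreover have "eval [oracle1 f, oracle1 \<rho>] ?b [x] = Some (b x)" for x
      unfolding b_def by (rule eval_MuI[OF _ ex_b]) simp
    moreover have "eval [oracle1 f, oracle1 \<rho>] ?e [b x, x] = Some (s x)" for x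
      unfolding s_def by (rule eval_MuI[OF _ ex_s]) simp
    ultimately show ?thesis
      by (intro exI[of _ "\<lambda>x. \<rho> (s x)"]) (auto simp: computes1_def oracle1_def)
  qed
  then show ?thesis
    unfolding computable_from11_iff[symmetric] computable_from11_def recursive_permutation_def
    by blast
qed

text \<open>The decider serves as a hub: any two of the other problems are then linked by passing
  through it.\<close>

lemma reducible_decider_each:
  assumes "S \<in> {cycle_minimum, cycle_representative, cycle_invariant, cycle_enumerator}"
  shows "reducible (problem2 cycle_decider) (problem1 S)"
    and "reducible (problem1 S) (problem2 cycle_decider)"
proof -
  note dec_inv = reducible_decider_invariant
  have inv_rep: "reducible (problem1 cycle_invariant) (problem1 cycle_representative)"
    by (rule reducible_problem1I) (rule cycle_representative_imp_invariant)
  have enum_rep: "reducible (problem1 cycle_enumerator) (problem1 cycle_representative)"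
    by (rule reducible_problem1I) (rule cycle_representative_imp_enumerator)
  have rep_min: "reducible (problem1 cycle_representative) (problem1 cycle_minimum)"
    by (rule reducible_problem1I) (rule cycle_minimum_imp_representative)
  note dec_rep = reducible_trans[OF dec_inv inv_rep]
  note dec_min = reducible_trans[OF dec_rep rep_min]
  note dec_enum = reducible_trans[OF dec_rep reducible_representative_enumerator]
  show "reducible (problem2 cycle_decider) (problem1 S)"
    using assms dec_inv dec_rep dec_min dec_enum by blast
  note min_dec = reducible_minimum_decider
  note rep_dec = reducible_trans[OF rep_min min_dec]
  note inv_dec = reducible_trans[OF inv_rep rep_dec]
  note enum_dec = reducible_trans[OF enum_rep rep_dec]
  show "reducible (problem1 S) (problem2 cycle_decider)"
    using assms min_dec rep_dec inv_dec enum_dec by blast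
qed

theorem theorem3p4:
  shows "(\<forall>f :: nat \<Rightarrow> nat. recursive_permutation f \<longrightarrow>
            ((\<exists>\<pi>. recursive2 \<pi> \<and> cycle_decider f \<pi>) \<longleftrightarrow> (\<exists>\<mu>. recursive1 \<mu> \<and> cycle_minimum f \<mu>)) \<and>
            ((\<exists>\<pi>. recursive2 \<pi> \<and> cycle_decider f \<pi>) \<longleftrightarrow> (\<exists>\<theta>. recursive1 \<theta> \<and> cycle_representative f \<theta>)) \<and>
            ((\<exists>\<pi>. recursive2 \<pi> \<and> cycle_decider f \<pi>) \<longleftrightarrow> (\<exists>\<chi>. recursive1 \<chi> \<and> cycle_invariant f \<chi>)) \<and>
            ((\<exists>\<pi>. recursive2 \<pi> \<and> cycle_decider f \<pi>) \<longleftrightarrow> (\<exists>\<rho>. recursive1 \<rho> \<and> cycle_enumerator f \<rho>))) \<and>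
         (\<forall>S \<in> {cycle_minimum, cycle_representative, cycle_invariant, cycle_enumerator}.
            computable_from21 cycle_decider S \<and>
            computable_from12 S cycle_decider \<and>
            (\<forall>T \<in> {cycle_minimum, cycle_representative, cycle_invariant, cycle_enumerator}.
               computable_from11 S T))"
proof (intro conjI allI impI ballI)
  fix f :: "nat \<Rightarrow> nat" assume f: "recursive_permutation f"
  have "(\<exists>\<pi>. recursive2 \<pi> \<and> cycle_decider f \<pi>) \<longleftrightarrow> (\<exists>g. recursive1 g \<and> S f g)"
    if "S \<in> {cycle_minimum, cycle_representative, cycle_invariant, cycle_enumerator}" for S
    unfolding recursively_solvable_problem1[symmetric] recursively_solvable_problem2[symmetric]
    using reducible_decider_each[OF that] recursively_solvable_reducible[OF _ f] by blast
  then show "(\<exists>\<pi>. recursive2 \<pi> \<and> cycle_decider f \<pi>) \<longleftrightarrow> (\<exists>\<mu>. recursive1 \<mu> \<and> cycle_minimum f \<mu>)"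
    "(\<exists>\<pi>. recursive2 \<pi> \<and> cycle_decider f \<pi>) \<longleftrightarrow> (\<exists>\<theta>. recursive1 \<theta> \<and> cycle_representative f \<theta>)"
    "(\<exists>\<pi>. recursive2 \<pi> \<and> cycle_decider f \<pi>) \<longleftrightarrow> (\<exists>\<chi>. recursive1 \<chi> \<and> cycle_invariant f \<chi>)"
    "(\<exists>\<pi>. recursive2 \<pi> \<and> cycle_decider f \<pi>) \<longleftrightarrow> (\<exists>\<rho>. recursive1 \<rho> \<and> cycle_enumerator f \<rho>)"
    by simp_all
next
  fix S T
  assume S: "S \<in> {cycle_minimum, cycle_representative, cycle_invariant, cycle_enumerator}"
  show "computable_from21 cycle_decider S" "computable_from12 S cycle_decider"
    using reducible_decider_each[OF S] by (simp_all add: computable_from12_iff computable_from21_iff)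
  assume T: "T \<in> {cycle_minimum, cycle_representative, cycle_invariant, cycle_enumerator}"
  show "computable_from11 S T"
    unfolding computable_from11_iff
    using reducible_decider_each(2)[OF T] reducible_decider_each(1)[OF S] by (rule reducible_trans)
qed

end
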